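(* Consider the problem $\min_{\mathbf{x}\in\mathcal{X}}\max_{|S|\le k}f(\mathbf{x},S)$, where $\mathcal{X}\subset\mathbb{R}^d$ is a convex set, and $f:\mathbb{R}^d\times2^V\to\mathbb{R}_+$ is convex in $\mathbf{x}$ for each fixed $S$ and monotone submodular in $S$ for each fixed $\mathbf{x}$. Suppose that: (1) $f$ is $L$-smooth with respect to $\mathbf{x}$, i.e. $\|\nabla_{\mathbf{x}}f(\mathbf{x},S)-\nabla_{\mathbf{x}}f(\mathbf{x}',S)\|\le L\|\mathbf{x}-\mathbf{x}'\|$ for all $\mathbf{x},\mathbf{x}'\in\mathbb{R}^d$ and all $S$ with $|S|\le k$; (2) the gradient of $f$ with respect to $\mathbf{x}$ is uniformly bounded by a constant $M$, i.e. $\|\nabla_{\mathbf{x}}f(\mathbf{x},S)\|\le M$ for all $\mathbf{x}\in\mathbb{R}^d$ and $S\in2^V$. Then the output $\mathbf{x}_{sol}$ of the Gradient Greedy (GG) algorithm after $\mathcal{O}(1/\epsilon^2)$ iterations with step size $\mathcal{O}(\epsilon)$ is a $((1-1/e),\epsilon)$-approximate minimax solution of the problem, i.e. $$(1-1/e)\max_{|S|\le k}f(\mathbf{x}_{sol},S)\le \min_{\mathbf{x}\in\mathcal{X}}\max_{|S|\le k}f(\mathbf{x},S)+\epsilon .$$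
   Context: $V$ is a finite ground set with $n$ elements and $k\le n$ is a positive integer. A set function $g:2^V\to\mathbb{R}$ is submodular if $g(A\cap B)+g(A\cup B)\le g(A)+g(B)$ for all $A,B\subseteq V$, and monotone if $g(A)\le g(B)$ whenever $A\subseteq B$. $\pi_{\mathcal{X}}$ denotes Euclidean projection onto $\mathcal{X}$, and $\nabla f(\mathbf{x},S)=\nabla_{\mathbf{x}}f(\mathbf{x},S)$. Greedy subroutine $\textsc{Greedy}(f,k,\mathbf{x})$: with $\Delta_ef(\mathbf{x},S)=f(\mathbf{x},S\cup\{e\})-f(\mathbf{x},S)$, start from the empty set $S_0=\emptyset$ and for $i=0,\dots,k-1$ set $S_{i+1}=S_i\cup\{\arg\max_{e\in V}\Delta_ef(\mathbf{x},S_i)\}$; return $S_k$. Gradient Greedy (GG): initialize $S_1=\emptyset$, $\mathbf{x}_1=\mathbf{0}$. For $t=1,\dots,T$: $\mathbf{x}_{t+1}=\pi_{\mathcal{X}}(\mathbf{x}_t-\gamma_t\nabla f(\mathbf{x}_t,S_t))$ and $S_{t+1}=\textsc{Greedy}(f,k,\mathbf{x}_{t+1})$, where $\gamma_t>0$ are step sizes. Output $\mathbf{x}_{sol}=\big(\sum_{t=1}^T\gamma_t\big)^{-1}\sum_{t=1}^T\gamma_t\mathbf{x}_t$. The $\mathcal{O}(\cdot)$ notation refers to the dependence on $\epsilon>0$. *)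

theory Defs
  imports "HOL-Analysis.Analysis" "HOL-Library.Landau_Symbols"
begin

definition submodular_on :: "'v set \<Rightarrow> ('v set \<Rightarrow> real) \<Rightarrow> bool" where
  "submodular_on V g \<longleftrightarrow>
     (\<forall>A\<in>Pow V. \<forall>B\<in>Pow V. g (A \<inter> B) + g (A \<union> B) \<le> g A + g B)"

definition gradient :: "('a::real_inner \<Rightarrow> real) \<Rightarrow> 'a \<Rightarrow> 'a" where
  "gradient F x = (THE D. GDERIV F x :> D)"

lemma GDERIV_gradient:
  fixes F :: "'a::euclidean_space \<Rightarrow> real"
  assumes "F differentiable (at x)"
  shows "GDERIV F x :> gradient F x"
proof -
  from assms obtain F' where F': "(F has_derivative F') (at x)"
    by (auto simp: differentiable_def)
  then interpret linear F'
    by (rule has_derivative_linear)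
  define D where "D = adjoint F' 1"
  have "F' = (\<lambda>h. inner h D)"
    using adjoint_works[OF linear_axioms, of _ 1] by (auto simp: D_def)
  then have D: "GDERIV F x :> D"
    using F' by (simp add: gderiv_def)
  moreover have "E = D" if "GDERIV F x :> E" for E
  proof -
    have "(\<lambda>h. inner h E) = (\<lambda>h. inner h D)"
      using that D unfolding gderiv_def by (rule has_derivative_unique)
    then have "inner h E = inner h D" for h
      by (rule fun_cong)
    then show ?thesis
      using vector_eq_ldot by blast
  qed
  ultimately show ?thesis
    unfolding gradient_def by (rule theI)
qed

definition max_value :: "('a \<Rightarrow> 'v set \<Rightarrow> real) \<Rightarrow> 'v set \<Rightarrow> nat \<Rightarrow> 'a \<Rightarrow> real" where
  "max_value f V k x = Max (f x ` {S \<in> Pow V. card S \<le> k})"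

text \<open>
  The infimum below stands for the minimum over \<open>X\<close> and is to be used only when that
  minimum is attained. Membership of the candidate point in \<open>X\<close> is not part of the notion.
\<close>

definition approx_minimax_solution ::
  "('a \<Rightarrow> 'v set \<Rightarrow> real) \<Rightarrow> 'v set \<Rightarrow> nat \<Rightarrow> 'a set \<Rightarrow> real \<Rightarrow> real \<Rightarrow> 'a \<Rightarrow> bool" where
  "approx_minimax_solution f V k X \<alpha> \<epsilon> z \<longleftrightarrow>
     \<alpha> * max_value f V k z \<le> (INF x\<in>X. max_value f V k x) + \<epsilon>"

definition marginal :: "('a \<Rightarrow> 'v set \<Rightarrow> real) \<Rightarrow> 'a \<Rightarrow> 'v set \<Rightarrow> 'v \<Rightarrow> real" where
  "marginal f x S e = f x (S \<union> {e}) - f x S"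

text \<open>
  The maximizing element need not be unique, so the greedy subroutine is a relation:
  \<open>greedy f V x k S\<close> says that \<open>S\<close> is the result after \<open>k\<close> steps for some way of breaking
  ties. The maximum ranges over all of \<open>V\<close>, so an element may be selected again.
\<close>

inductive greedy :: "('a \<Rightarrow> 'v set \<Rightarrow> real) \<Rightarrow> 'v set \<Rightarrow> 'a \<Rightarrow> nat \<Rightarrow> 'v set \<Rightarrow> bool"
  for f V x where
  "greedy f V x 0 {}"
| "greedy f V x i S \<Longrightarrow> is_arg_max (marginal f x S) (\<lambda>e. e \<in> V) e
     \<Longrightarrow> greedy f V x (Suc i) (S \<union> {e})"

definition gradient_greedy_run ::
  "('a::euclidean_space \<Rightarrow> 'v set \<Rightarrow> real) \<Rightarrow> 'v set \<Rightarrow> nat \<Rightarrow> 'a set \<Rightarrow> (nat \<Rightarrow> real) \<Rightarrow> nat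
     \<Rightarrow> (nat \<Rightarrow> 'a) \<Rightarrow> (nat \<Rightarrow> 'v set) \<Rightarrow> bool" where
  "gradient_greedy_run f V k X \<gamma> T x S \<longleftrightarrow>
     x 1 = 0 \<and> S 1 = {} \<and>
     (\<forall>t\<in>{1..T}.
        x (t + 1) = closest_point X (x t - \<gamma> t *\<^sub>R gradient (\<lambda>y. f y (S t)) (x t)) \<and>
        greedy f V (x (t + 1)) k (S (t + 1)))"

definition gradient_greedy_output ::
  "('a::euclidean_space \<Rightarrow> 'v set \<Rightarrow> real) \<Rightarrow> 'v set \<Rightarrow> nat \<Rightarrow> 'a set \<Rightarrow> (nat \<Rightarrow> real) \<Rightarrow> nat
     \<Rightarrow> 'a \<Rightarrow> bool" where
  "gradient_greedy_output f V k X \<gamma> T z \<longleftrightarrow>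
     (\<exists>x S. gradient_greedy_run f V k X \<gamma> T x S \<and>
        z = inverse (\<Sum>t=1..T. \<gamma> t) *\<^sub>R (\<Sum>t=1..T. \<gamma> t *\<^sub>R x t))"

lemma greedy_exists:
  assumes "finite V" "V \<noteq> {}"
  shows "\<exists>S. greedy f V x k S"
proof (induction k)
  case 0
  show ?case
    by (blast intro: greedy.intros)
next
  case (Suc k)
  then obtain S where S: "greedy f V x k S"
    by blast
  obtain e where "is_arg_max (marginal f x S) (\<lambda>e. e \<in> V) e"
    using ex_is_arg_min_if_finite[OF assms, of "\<lambda>e. - marginal f x S e"]
    by (auto simp: is_arg_max_def is_arg_min_def)
  with S show ?case
    by (blast intro: greedy.intros)
qed

lemma gradient_greedy_output_exists:
  assumes "finite V" "V \<noteq> {}"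
  shows "\<exists>z. gradient_greedy_output f V k X \<gamma> T z"
proof -
  define G where "G x = (SOME S. greedy f V x k S)" for x
  have G: "greedy f V x k (G x)" for x
    unfolding G_def using greedy_exists[OF assms] by (rule someI_ex)
  define step where "step t p =
    (let y = closest_point X (fst p - \<gamma> t *\<^sub>R gradient (\<lambda>y. f y (snd p)) (fst p)) in (y, G y))"
    for t p
  define run where "run = rec_nat (0, {}) (\<lambda>i. step (Suc i))"
  define x where "x t = fst (run (t - 1))" for t
  define S where "S t = snd (run (t - 1))" for t
  have "gradient_greedy_run f V k X \<gamma> T x S"
    unfolding gradient_greedy_run_def
  proof (intro conjI ballI)
    show "x 1 = 0" "S 1 = {}"
      by (simp_all add: x_def S_def run_def)
    fix t assume "t \<in> {1..T}"
    then obtain i where t: "t = Suc i"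
      by (cases t) auto
    show "x (t + 1) = closest_point X (x t - \<gamma> t *\<^sub>R gradient (\<lambda>y. f y (S t)) (x t))"
      by (simp add: t x_def S_def run_def step_def Let_def)
    show "greedy f V (x (t + 1)) k (S (t + 1))"
      by (simp add: t x_def S_def run_def step_def Let_def G)
  qed
  then show ?thesis
    unfolding gradient_greedy_output_def by blast
qed

end

theory Submission
  imports Defs
begin

text \<open>
  Write \<open>\<phi> x\<close> for \<open>max_value f V k x\<close>, \<open>\<alpha>\<close> for \<open>1 - 1 / exp 1\<close>, and let \<open>u\<close> be a
  minimizer of \<open>\<phi>\<close> over \<open>X\<close>. For a fixed point, greedy selection is an
  \<open>\<alpha>\<close>-approximation to the inner maximum (\<open>greedy_approximation\<close>), so the set \<open>S t\<close>
  held at iteration \<open>t > 1\<close> satisfies \<open>\<alpha> * \<phi> (x t) \<le> f (x t) (S t)\<close>.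
  In the point variable, the algorithm is online projected gradient descent on the convex losses
  \<open>\<lambda>y. f y (S t)\<close>. Its regret against \<open>u\<close> is bounded however the sets \<open>S t\<close> are
  chosen (\<open>projected_gradient_regret\<close>), and the loss at \<open>u\<close> never exceeds \<open>\<phi> u\<close>.

  Averaging over the iterations and using Jensen's inequality for the convex function \<open>\<phi>\<close>
  yields, for gradients of norm at most \<open>M\<close>, a constant step size \<open>\<gamma>\<close> and \<open>T\<close> iterations (\<open>gradient_greedy_error\<close>),
  \<open>\<alpha> * \<phi> z \<le> \<phi> u + \<phi> 0 / T + (norm u)\<^sup>2 / (2 * \<gamma> * T) + M\<^sup>2 * \<gamma> / 2\<close>,
  where \<open>\<phi> 0 / T\<close> accounts for the first iteration, whose set is empty. Taking \<open>\<gamma>\<close>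
  proportional to \<open>\<epsilon>\<close> and \<open>T\<close> of order \<open>1 / \<epsilon>\<^sup>2\<close> bounds the error by \<open>\<epsilon>\<close>.
\<close>

section \<open>The greedy guarantee\<close>

lemma submodular_on_union_le_sum_marginals:
  assumes "submodular_on V g" and "A \<subseteq> V" and "finite B" and "B \<subseteq> V"
  shows "g (A \<union> B) \<le> g A + (\<Sum>e\<in>B. g (A \<union> {e}) - g A)"
  using assms(3,4)
proof (induction B rule: finite_induct)
  case empty
  then show ?case by simp
next
  case (insert b B)
  \<comment> \<open>This holds whether or not \<open>b\<close> lies in \<open>A\<close>, so no disjointness is needed.\<close>
  have "(A \<union> B) \<inter> (A \<union> {b}) = A" and "(A \<union> B) \<union> (A \<union> {b}) = A \<union> insert b B"
    using insert.hyps by auto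
  moreover have "A \<union> B \<in> Pow V" and "A \<union> {b} \<in> Pow V"
    using \<open>A \<subseteq> V\<close> insert.prems by auto
  ultimately have "g A + g (A \<union> insert b B) \<le> g (A \<union> B) + g (A \<union> {b})"
    using assms(1) unfolding submodular_on_def by metis
  moreover have "g (A \<union> B) \<le> g A + (\<Sum>e\<in>B. g (A \<union> {e}) - g A)"
    using insert by auto
  ultimately show ?case
    using insert.hyps by simp
qed

lemma greedy_feasible:
  assumes "greedy f V x i S"
  shows "S \<subseteq> V \<and> finite S \<and> card S \<le> i"
  using assms
proof induction
  case 1
  then show ?case by simp
next
  case (2 i S e)
  moreover have "e \<in> V"
    using 2 by (simp add: is_arg_max_def)
  moreover have "card (insert e S) \<le> Suc (card S)"
    by (rule card_insert_le_m1) auto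
  ultimately show ?case
    by auto
qed

text \<open>
  By submodularity and monotonicity, the marginals at \<open>S\<close> of the at most \<open>k\<close> elements of
  \<open>B\<close> sum to at least the gap \<open>f x B - f x S\<close>, so the largest marginal closes at least a
  \<open>1 / k\<close> fraction of it and each greedy step contracts the gap by \<open>1 - 1 / k\<close>. The value
  \<open>f x {}\<close> need not be \<open>0\<close>.
\<close>

lemma greedy_gap_le:
  assumes mono: "mono_on (Pow V) (f x)" and sub: "submodular_on V (f x)"
    and "1 \<le> k" and B: "B \<subseteq> V" "finite B" "card B \<le> k"
    and "greedy f V x i S"
  shows "f x B - f x S \<le> (1 - 1 / real k) ^ i * (f x B - f x {})"
  using assms(7)
proof induction
  case 1
  then show ?case by simp
next
  case (2 i S e)
  have S: "S \<subseteq> V"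
    using greedy_feasible[OF 2(1)] by simp
  have max: "marginal f x S e' \<le> marginal f x S e" if "e' \<in> V" for e'
    using 2(2) that by (auto simp: is_arg_max_def not_less)
  have eV: "e \<in> V"
    using 2(2) by (simp add: is_arg_max_def)
  have nonneg: "0 \<le> marginal f x S e"
    unfolding marginal_def using mono_onD[OF mono, of S "S \<union> {e}"] S eV by auto
  have "f x B \<le> f x (S \<union> B)"
    using mono_onD[OF mono, of B "S \<union> B"] S B by auto
  also have "\<dots> \<le> f x S + (\<Sum>e'\<in>B. marginal f x S e')"
    unfolding marginal_def using submodular_on_union_le_sum_marginals[OF sub S B(2,1)] .
  also have "\<dots> \<le> f x S + real (card B) * marginal f x S e"
    using sum_bounded_above[of B "marginal f x S" "marginal f x S e"] B(1) max by auto
  also have "\<dots> \<le> f x S + real k * marginal f x S e"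
    using B(3) nonneg by (simp add: mult_right_mono)
  finally have "(f x B - f x S) / k \<le> marginal f x S e"
    using \<open>1 \<le> k\<close> by (simp add: field_simps)
  then have "f x B - f x (S \<union> {e}) \<le> (1 - 1 / k) * (f x B - f x S)"
    by (simp add: marginal_def algebra_simps diff_divide_distrib)
  also have "\<dots> \<le> (1 - 1 / k) * ((1 - 1 / k) ^ i * (f x B - f x {}))"
    using \<open>1 \<le> k\<close> by (intro mult_left_mono 2) auto
  finally show ?case
    by simp
qed

lemma greedy_approximation:
  assumes "mono_on (Pow V) (f x)" and "submodular_on V (f x)" and nonneg: "0 \<le> f x {}"
    and "1 \<le> k" and B: "B \<subseteq> V" "finite B" "card B \<le> k" and "greedy f V x k S"
  shows "(1 - 1 / exp 1) * f x B \<le> f x S"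
proof -
  have "f x {} \<le> f x B"
    using mono_onD[OF assms(1), of "{}" B] B by auto
  have "(1 - 1 / real k) ^ k \<le> exp (- 1)"
    using exp_ge_one_minus_x_over_n_power_n[of 1 k] \<open>1 \<le> k\<close> by simp
  then have "(1 - 1 / real k) ^ k * (f x B - f x {}) \<le> exp (- 1) * (f x B - f x {})"
    using \<open>f x {} \<le> f x B\<close> by (intro mult_right_mono) auto
  also have "\<dots> \<le> exp (- 1) * f x B"
    using nonneg by simp
  finally have "f x B - f x S \<le> exp (- 1) * f x B"
    using greedy_gap_le[OF assms(1,2,4) B assms(8)] by linarith
  then show ?thesis
    by (simp add: exp_minus field_simps)
qed

section \<open>The inner maximum\<close>

lemma max_value_upper:
  assumes "finite V" and "S \<subseteq> V" and "card S \<le> k"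
  shows "f x S \<le> max_value f V k x"
  unfolding max_value_def using assms by (auto intro!: Max_ge)

lemma max_value_attained:
  assumes "finite V"
  obtains S where "S \<subseteq> V" and "card S \<le> k" and "max_value f V k x = f x S"
proof -
  have "{} \<in> {S \<in> Pow V. card S \<le> k}"
    by simp
  then have "Max (f x ` {S \<in> Pow V. card S \<le> k}) \<in> f x ` {S \<in> Pow V. card S \<le> k}"
    using assms by (intro Max_in) auto
  then show ?thesis
    using that unfolding max_value_def by auto
qed

lemma convex_on_max_value:
  assumes "finite V" and "convex C" and "\<And>S. S \<subseteq> V \<Longrightarrow> convex_on C (\<lambda>x. f x S)"
  shows "convex_on C (max_value f V k)"
proof (rule convex_onI)
  fix t :: real and x y
  assume t: "0 < t" "t < 1" and xy: "x \<in> C" "y \<in> C"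
  obtain S where S: "S \<subseteq> V" "card S \<le> k"
    and eq: "max_value f V k ((1 - t) *\<^sub>R x + t *\<^sub>R y) = f ((1 - t) *\<^sub>R x + t *\<^sub>R y) S"
    using max_value_attained[OF assms(1), where f = f and k = k
        and x = "(1 - t) *\<^sub>R x + t *\<^sub>R y"] by metis
  have "f ((1 - t) *\<^sub>R x + t *\<^sub>R y) S \<le> (1 - t) * f x S + t * f y S"
    using convex_onD[OF assms(3)[OF S(1)], of t x y] t xy by simp
  also have "\<dots> \<le> (1 - t) * max_value f V k x + t * max_value f V k y"
    using t by (intro add_mono mult_left_mono max_value_upper assms(1) S) auto
  finally show "max_value f V k ((1 - t) *\<^sub>R x + t *\<^sub>R y)
      \<le> (1 - t) * max_value f V k x + t * max_value f V k y"
    unfolding eq .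
qed (fact assms(2))

section \<open>Projected gradient descent\<close>

lemma convex_on_above_gradient:
  fixes F :: "'a::real_inner \<Rightarrow> real"
  assumes convex: "convex_on UNIV F" and D: "GDERIV F x :> D"
  shows "F x - F y \<le> inner (x - y) D"
proof -
  \<comment> \<open>Restricting \<open>F\<close> to the line through \<open>x\<close> and \<open>y\<close> reduces the claim to the tangent
    inequality in one variable.\<close>
  define h where "h t = x + t *\<^sub>R (y - x)" for t
  have h: "h ((1 - t) * a + t * b) = (1 - t) *\<^sub>R h a + t *\<^sub>R h b" for t a b
    by (simp add: h_def algebra_simps)
  have "convex_on UNIV (\<lambda>t. F (h t))"
  proof (rule convex_onI)
    show "F (h ((1 - t) *\<^sub>R a + t *\<^sub>R b)) \<le> (1 - t) * F (h a) + t * F (h b)"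
      if "0 < t" "t < 1" for t a b :: real
      using convex_onD[OF convex, of t "h a" "h b"] that by (simp add: h)
  qed simp
  moreover have "((\<lambda>t. F (h t)) has_real_derivative inner (y - x) D) (at 0)"
  proof -
    have "(h has_derivative (\<lambda>t. t *\<^sub>R (y - x))) (at 0)"
      unfolding h_def by (auto intro!: derivative_eq_intros)
    moreover have "(F has_derivative (\<lambda>v. inner v D)) (at (h 0))"
      using D by (simp add: gderiv_def h_def)
    ultimately have "((\<lambda>t. F (h t)) has_derivative (\<lambda>t. inner (t *\<^sub>R (y - x)) D)) (at 0)"
      by (rule has_derivative_compose)
    then show ?thesis
      by (simp add: has_field_derivative_def mult_commute_abs)
  qed
  ultimately have "inner (y - x) D * (1 - 0) \<le> F (h 1) - F (h 0)"
    by (intro convex_on_imp_above_tangent[where A = UNIV]) auto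
  then show ?thesis
    by (simp add: h_def inner_diff_left)
qed

text \<open>
  One projected step, measured by the squared distance to a reference point \<open>u\<close>; the
  starting point \<open>x\<close> may lie outside \<open>X\<close>, since only its image is compared with \<open>u\<close>.
\<close>

lemma closest_point_gradient_step:
  fixes x u g :: "'a::euclidean_space"
  assumes "convex X" and "closed X" and "u \<in> X" and "norm g \<le> M"
  shows "2 * c * inner (x - u) g
    \<le> (norm (x - u))\<^sup>2 - (norm (closest_point X (x - c *\<^sub>R g) - u))\<^sup>2 + c\<^sup>2 * M\<^sup>2"
proof -
  have "dist (closest_point X (x - c *\<^sub>R g)) (closest_point X u) \<le> dist (x - c *\<^sub>R g) u"
    using assms by (intro closest_point_lipschitz) auto
  then have "norm (closest_point X (x - c *\<^sub>R g) - u) \<le> norm (x - u - c *\<^sub>R g)"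
    using closest_point_self[OF \<open>u \<in> X\<close>] by (simp add: dist_norm algebra_simps)
  then have "(norm (closest_point X (x - c *\<^sub>R g) - u))\<^sup>2 \<le> (norm (x - u - c *\<^sub>R g))\<^sup>2"
    by (intro power_mono) auto
  also have "\<dots> = (norm (x - u))\<^sup>2 - 2 * c * inner (x - u) g + c\<^sup>2 * (norm g)\<^sup>2"
    unfolding power2_norm_eq_inner
    by (simp add: inner_diff_left inner_diff_right inner_commute power2_eq_square algebra_simps)
  also have "c\<^sup>2 * (norm g)\<^sup>2 \<le> c\<^sup>2 * M\<^sup>2"
    using assms by (intro mult_left_mono power_mono) auto
  finally show ?thesis
    by simp
qed

lemma projected_gradient_regret:
  fixes x :: "nat \<Rightarrow> 'a::euclidean_space"
  assumes X: "convex X" "closed X" "u \<in> X"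
    and step: "\<And>t. t \<in> {1..T} \<Longrightarrow> x (t + 1) = closest_point X (x t - c t *\<^sub>R g t)"
    and bound: "\<And>t. t \<in> {1..T} \<Longrightarrow> norm (g t) \<le> M"
  shows "(\<Sum>t=1..T. c t * inner (x t - u) (g t))
    \<le> (norm (x 1 - u))\<^sup>2 / 2 + M\<^sup>2 / 2 * (\<Sum>t=1..T. (c t)\<^sup>2)"
proof -
  have "2 * (\<Sum>t=1..T. c t * inner (x t - u) (g t))
      \<le> (\<Sum>t=1..T. (norm (x t - u))\<^sup>2 - (norm (x (Suc t) - u))\<^sup>2 + (c t)\<^sup>2 * M\<^sup>2)"
    unfolding sum_distrib_left
    using closest_point_gradient_step[OF X bound] step by (intro sum_mono) (simp add: mult.assoc)
  also have "\<dots> = (norm (x 1 - u))\<^sup>2 - (norm (x (Suc T) - u))\<^sup>2 + M\<^sup>2 * (\<Sum>t=1..T. (c t)\<^sup>2)"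
    by (induction T) (simp_all add: algebra_simps)
  also have "\<dots> \<le> (norm (x 1 - u))\<^sup>2 + M\<^sup>2 * (\<Sum>t=1..T. (c t)\<^sup>2)"
    by simp
  finally show ?thesis
    by simp
qed

section \<open>Convergence of Gradient Greedy\<close>

text \<open>
  Error bound for arbitrary positive step sizes, against any \<open>u\<close> in \<open>X\<close>. The term \<open>max_value f V k 0\<close> is the price of the
  initial pair \<open>(0, {})\<close>, whose set is not a greedy set for its point.
\<close>

lemma gradient_greedy_error:
  fixes f :: "'a::euclidean_space \<Rightarrow> 'v set \<Rightarrow> real"
  assumes V: "finite V" and k: "1 \<le> k" and X: "convex X" "closed X" "u \<in> X"
    and nonneg: "\<And>x S. S \<subseteq> V \<Longrightarrow> 0 \<le> f x S"
    and convex_f: "\<And>S. S \<subseteq> V \<Longrightarrow> convex_on UNIV (\<lambda>x. f x S)"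
    and monotone: "\<And>x. mono_on (Pow V) (f x)"
    and submodular: "\<And>x. submodular_on V (f x)"
    and differentiable: "\<And>x S. S \<subseteq> V \<Longrightarrow> (\<lambda>y. f y S) differentiable (at x)"
    and bounded: "\<And>x S. S \<subseteq> V \<Longrightarrow> norm (gradient (\<lambda>y. f y S) x) \<le> M"
    and T: "1 \<le> T" and \<gamma>: "\<And>t. t \<in> {1..T} \<Longrightarrow> 0 < \<gamma> t"
    and z: "gradient_greedy_output f V k X \<gamma> T z"
  shows "(1 - 1 / exp 1) * max_value f V k z \<le> max_value f V k u
    + (\<gamma> 1 * max_value f V k 0 + (norm u)\<^sup>2 / 2 + M\<^sup>2 / 2 * (\<Sum>t=1..T. (\<gamma> t)\<^sup>2))
      / (\<Sum>t=1..T. \<gamma> t)"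
proof -
  define \<phi> where "\<phi> = max_value f V k"
  define \<alpha> :: real where "\<alpha> = 1 - 1 / exp 1"
  have \<alpha>: "0 \<le> \<alpha>" "\<alpha> \<le> 1"
    unfolding \<alpha>_def by simp_all
  obtain x S where run: "gradient_greedy_run f V k X \<gamma> T x S"
    and z_eq: "z = inverse (\<Sum>t=1..T. \<gamma> t) *\<^sub>R (\<Sum>t=1..T. \<gamma> t *\<^sub>R x t)"
    using z unfolding gradient_greedy_output_def by blast
  have init: "x 1 = 0" "S 1 = {}"
    and step: "\<And>t. t \<in> {1..T} \<Longrightarrow>
      x (t + 1) = closest_point X (x t - \<gamma> t *\<^sub>R gradient (\<lambda>y. f y (S t)) (x t))"
    and gr: "\<And>t. t \<in> {1..T} \<Longrightarrow> greedy f V (x (t + 1)) k (S (t + 1))"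
    using run unfolding gradient_greedy_run_def by blast+
  have greedy: "greedy f V (x t) k (S t)" if "t \<in> {1..T}" "t \<noteq> 1" for t
  proof -
    have "t - 1 \<in> {1..T}" and "t - 1 + 1 = t"
      using that by auto
    then show ?thesis
      using gr[of "t - 1"] by metis
  qed
  have S: "S t \<subseteq> V" "card (S t) \<le> k" if "t \<in> {1..T}" for t
    using greedy_feasible[OF greedy[OF that]] init by (cases "t = 1"; auto)+
  define \<Gamma> where "\<Gamma> = (\<Sum>t=1..T. \<gamma> t)"
  have \<Gamma>: "0 < \<Gamma>"
    unfolding \<Gamma>_def using \<gamma> T by (intro sum_pos) auto
  have \<phi>_nonneg: "0 \<le> \<phi> y" for y
    unfolding \<phi>_def using nonneg[of "{}" y] max_value_upper[OF V, of "{}" k f y] by simp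
  have approx: "\<alpha> * \<phi> (x t) \<le> f (x t) (S t) + (if t = 1 then \<phi> 0 else 0)" if t: "t \<in> {1..T}" for t
  proof (cases "t = 1")
    case True
    have "\<alpha> * \<phi> 0 \<le> \<phi> 0"
      using \<alpha> \<phi>_nonneg[of 0] by (simp add: mult_left_le_one_le)
    then show ?thesis
      using True init nonneg[of "{}" 0] by simp
  next
    case False
    obtain B where B: "B \<subseteq> V" "card B \<le> k" and eq: "\<phi> (x t) = f (x t) B"
      unfolding \<phi>_def using max_value_attained[OF V] .
    have "finite B"
      using B V finite_subset by blast
    with greedy_approximation[OF monotone submodular nonneg k B(1) _ B(2) greedy[OF t False]]
    show ?thesis
      using False by (simp add: eq \<alpha>_def)
  qed
  have tangent: "f (x t) (S t) - \<phi> u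
      \<le> inner (x t - u) (gradient (\<lambda>y. f y (S t)) (x t))" if t: "t \<in> {1..T}" for t
  proof -
    have "f (x t) (S t) - f u (S t) \<le> inner (x t - u) (gradient (\<lambda>y. f y (S t)) (x t))"
      using convex_on_above_gradient[OF convex_f GDERIV_gradient[OF differentiable]] S[OF t] by blast
    moreover have "f u (S t) \<le> \<phi> u"
      unfolding \<phi>_def using max_value_upper[OF V S[OF t]] .
    ultimately show ?thesis
      by linarith
  qed
  have "\<phi> z \<le> (\<Sum>t=1..T. \<gamma> t / \<Gamma> * \<phi> (x t))"
  proof -
    have z_sum: "z = (\<Sum>t=1..T. (\<gamma> t / \<Gamma>) *\<^sub>R x t)"
      unfolding z_eq \<Gamma>_def[symmetric] by (simp add: scaleR_sum_right divide_inverse mult.commute)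
    have "convex_on UNIV \<phi>"
      unfolding \<phi>_def using convex_on_max_value[OF V convex_UNIV convex_f] .
    moreover have "(\<Sum>t=1..T. \<gamma> t / \<Gamma>) = 1"
      unfolding sum_divide_distrib[symmetric] \<Gamma>_def[symmetric] using \<Gamma> by simp
    ultimately show ?thesis
      unfolding z_sum using T \<gamma> \<Gamma> by (intro convex_on_sum) (auto intro: less_imp_le)
  qed
  \<comment> \<open>All estimates are kept multiplied by the total step size \<open>\<Gamma>\<close> until the end.\<close>
  then have "\<Gamma> * (\<alpha> * \<phi> z) \<le> \<Gamma> * (\<alpha> * (\<Sum>t=1..T. \<gamma> t / \<Gamma> * \<phi> (x t)))"
    using \<Gamma> \<alpha> by (intro mult_left_mono) auto
  also have "\<dots> = (\<Sum>t=1..T. \<gamma> t * (\<alpha> * \<phi> (x t)))"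
    using \<Gamma> by (simp add: sum_distrib_left mult_ac)
  also have "\<dots> \<le> (\<Sum>t=1..T. \<gamma> t * \<phi> u + (if t = 1 then \<gamma> 1 * \<phi> 0 else 0)
      + \<gamma> t * inner (x t - u) (gradient (\<lambda>y. f y (S t)) (x t)))"
  proof (rule sum_mono)
    fix t assume t: "t \<in> {1..T}"
    have "\<gamma> t * (\<alpha> * \<phi> (x t)) \<le> \<gamma> t * (\<phi> u + (if t = 1 then \<phi> 0 else 0)
        + inner (x t - u) (gradient (\<lambda>y. f y (S t)) (x t)))"
      using approx[OF t] tangent[OF t] \<gamma>[OF t] by (intro mult_left_mono) auto
    then show "\<gamma> t * (\<alpha> * \<phi> (x t)) \<le> \<gamma> t * \<phi> u + (if t = 1 then \<gamma> 1 * \<phi> 0 else 0)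
        + \<gamma> t * inner (x t - u) (gradient (\<lambda>y. f y (S t)) (x t))"
      by (cases "t = 1") (simp_all add: algebra_simps)
  qed
  also have "\<dots> = \<Gamma> * \<phi> u + \<gamma> 1 * \<phi> 0
      + (\<Sum>t=1..T. \<gamma> t * inner (x t - u) (gradient (\<lambda>y. f y (S t)) (x t)))"
    using T by (simp add: sum.distrib sum_distrib_right \<Gamma>_def)
  also have "\<dots> \<le> \<Gamma> * \<phi> u + \<gamma> 1 * \<phi> 0
      + ((norm u)\<^sup>2 / 2 + M\<^sup>2 / 2 * (\<Sum>t=1..T. (\<gamma> t)\<^sup>2))"
    using projected_gradient_regret[OF X, where x = x and c = \<gamma> and T = T and M = M
        and g = "\<lambda>t. gradient (\<lambda>y. f y (S t)) (x t)"] step bounded S(1) init by simp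
  finally show ?thesis
    unfolding \<phi>_def[symmetric] \<alpha>_def[symmetric] \<Gamma>_def[symmetric]
    using \<Gamma> by (simp add: field_simps)
qed

theorem theorem3:
  fixes f :: "real ^ 'd \<Rightarrow> 'v set \<Rightarrow> real"
    and V :: "'v set" and X :: "(real ^ 'd) set"
    and k :: nat and L M :: real
  assumes "finite V" and "1 \<le> k" and "k \<le> card V"
    and "convex X" and "closed X"
    and minimum_attained: "\<exists>x\<in>X. \<forall>y\<in>X. max_value f V k x \<le> max_value f V k y"
    and nonneg: "\<And>x S. S \<subseteq> V \<Longrightarrow> 0 \<le> f x S"
    and convex_f: "\<And>S. S \<subseteq> V \<Longrightarrow> convex_on UNIV (\<lambda>x. f x S)"
    and monotone: "\<And>x. mono_on (Pow V) (f x)"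
    and submodular: "\<And>x. submodular_on V (f x)"
    and differentiable: "\<And>x S. S \<subseteq> V \<Longrightarrow> (\<lambda>y. f y S) differentiable (at x)"
    and smooth: "\<And>x x' S. S \<subseteq> V \<Longrightarrow> card S \<le> k \<Longrightarrow>
      norm (gradient (\<lambda>y. f y S) x - gradient (\<lambda>y. f y S) x') \<le> L * norm (x - x')"
    and bounded: "\<And>x S. S \<subseteq> V \<Longrightarrow> norm (gradient (\<lambda>y. f y S) x) \<le> M"
  shows "\<exists>(T :: real \<Rightarrow> nat) (\<gamma> :: real \<Rightarrow> real).
    (\<lambda>\<epsilon>. real (T \<epsilon>)) \<in> O[at_right 0](\<lambda>\<epsilon>. 1 / \<epsilon>\<^sup>2) \<and>
    \<gamma> \<in> O[at_right 0](\<lambda>\<epsilon>. \<epsilon>) \<and>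
    (\<forall>\<epsilon>>0. T \<epsilon> \<ge> 1 \<and> \<gamma> \<epsilon> > 0 \<and>
      (\<forall>z. gradient_greedy_output f V k X (\<lambda>_. \<gamma> \<epsilon>) (T \<epsilon>) z \<longrightarrow>
        approx_minimax_solution f V k X (1 - 1 / exp 1) \<epsilon> z))"
proof -
  obtain u where u: "u \<in> X" and min: "\<And>y. y \<in> X \<Longrightarrow> max_value f V k u \<le> max_value f V k y"
    using minimum_attained by blast
  have inf: "(INF x\<in>X. max_value f V k x) = max_value f V k u"
    using u min by (intro cInf_eq_minimum) auto
  define \<phi>\<^sub>0 where "\<phi>\<^sub>0 = max_value f V k 0"
  have \<phi>\<^sub>0: "0 \<le> \<phi>\<^sub>0"
    unfolding \<phi>\<^sub>0_def
    using nonneg[of "{}" 0] max_value_upper[OF \<open>finite V\<close>, of "{}" k f 0] by simp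
  \<comment> \<open>Adding 1 keeps the step size positive and well defined when \<open>M\<close> vanishes.\<close>
  define m where "m = M\<^sup>2 + 1"
  have m: "1 \<le> m" "M\<^sup>2 \<le> m"
    by (auto simp: m_def)
  define C where "C = 2 * (norm u)\<^sup>2 * m"
  have C: "0 \<le> C"
    using m by (simp add: C_def)
  define \<gamma> where "\<gamma> \<epsilon> = \<epsilon> / m" for \<epsilon> :: real
  \<comment> \<open>The summands of \<open>T\<close> bring the initial-set and distance errors below \<open>\<epsilon> / 4\<close> each;
    the choice of \<open>\<gamma>\<close> leaves at most \<open>\<epsilon> / 2\<close> for the gradient error.\<close>
  define T where "T \<epsilon> = nat \<lceil>1 + 4 * \<phi>\<^sub>0 / \<epsilon> + C / \<epsilon>\<^sup>2\<rceil>" for \<epsilon> :: real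
  have T_lower: "1 + 4 * \<phi>\<^sub>0 / \<epsilon> + C / \<epsilon>\<^sup>2 \<le> T \<epsilon>" for \<epsilon>
    unfolding T_def by linarith
  have "\<forall>\<^sub>F \<epsilon> in at_right 0. real (T \<epsilon>) \<le> (2 + 4 * \<phi>\<^sub>0 + C) * (1 / \<epsilon>\<^sup>2)"
    using eventually_at_right_real[OF zero_less_one]
  proof eventually_elim
    case (elim \<epsilon>)
    then have \<epsilon>: "0 < \<epsilon>" "\<epsilon> \<le> 1"
      by auto
    then have \<epsilon>2: "\<epsilon>\<^sup>2 \<le> \<epsilon>" "\<epsilon>\<^sup>2 \<le> 1"
      by (auto simp: power2_eq_square mult_le_one)
    have "0 \<le> 4 * \<phi>\<^sub>0 / \<epsilon>" "0 \<le> C / \<epsilon>\<^sup>2"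
      using \<epsilon> \<phi>\<^sub>0 C by simp_all
    then have "real (T \<epsilon>) \<le> 2 + 4 * \<phi>\<^sub>0 / \<epsilon> + C / \<epsilon>\<^sup>2"
      unfolding T_def by linarith
    also have "\<dots> \<le> 2 / \<epsilon>\<^sup>2 + 4 * \<phi>\<^sub>0 / \<epsilon>\<^sup>2 + C / \<epsilon>\<^sup>2"
      using \<epsilon> \<epsilon>2 \<phi>\<^sub>0 C by (intro add_mono divide_left_mono) (auto simp: field_simps)
    finally show ?case
      by (simp add: add_divide_distrib)
  qed
  then have "(\<lambda>\<epsilon>. real (T \<epsilon>)) \<in> O[at_right 0](\<lambda>\<epsilon>. 1 / \<epsilon>\<^sup>2)"
    by (intro bigoI[where c = "2 + 4 * \<phi>\<^sub>0 + C"]) simp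
  moreover have "\<gamma> \<in> O[at_right 0](\<lambda>\<epsilon>. \<epsilon>)"
    unfolding \<gamma>_def using m by (simp add: divide_inverse)
  moreover have "T \<epsilon> \<ge> 1 \<and> \<gamma> \<epsilon> > 0 \<and>
      (\<forall>z. gradient_greedy_output f V k X (\<lambda>_. \<gamma> \<epsilon>) (T \<epsilon>) z \<longrightarrow>
        approx_minimax_solution f V k X (1 - 1 / exp 1) \<epsilon> z)" if \<epsilon>: "\<epsilon> > 0" for \<epsilon>
  proof (intro conjI allI impI)
    have parts: "0 \<le> 4 * \<phi>\<^sub>0 / \<epsilon>" "0 \<le> C / \<epsilon>\<^sup>2"
      using \<epsilon> \<phi>\<^sub>0 C by simp_all
    show T: "T \<epsilon> \<ge> 1"
      using T_lower[of \<epsilon>] parts by linarith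
    show \<gamma>: "\<gamma> \<epsilon> > 0"
      using \<epsilon> m by (simp add: \<gamma>_def)
    fix z assume z: "gradient_greedy_output f V k X (\<lambda>_. \<gamma> \<epsilon>) (T \<epsilon>) z"
    define n where "n = real (T \<epsilon>)"
    have n: "0 < n"
      using T by (simp add: n_def)
    have "(1 - 1 / exp 1) * max_value f V k z \<le> max_value f V k u
        + (\<gamma> \<epsilon> * \<phi>\<^sub>0 + (norm u)\<^sup>2 / 2 + M\<^sup>2 / 2 * (n * (\<gamma> \<epsilon>)\<^sup>2)) / (n * \<gamma> \<epsilon>)"
      using gradient_greedy_error[OF \<open>finite V\<close> \<open>1 \<le> k\<close> \<open>convex X\<close> \<open>closed X\<close> u nonneg convex_f
          monotone submodular differentiable bounded T _ z] \<gamma>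
      by (simp add: n_def \<phi>\<^sub>0_def)
    also have "(\<gamma> \<epsilon> * \<phi>\<^sub>0 + (norm u)\<^sup>2 / 2 + M\<^sup>2 / 2 * (n * (\<gamma> \<epsilon>)\<^sup>2)) / (n * \<gamma> \<epsilon>)
        = \<phi>\<^sub>0 / n + (norm u)\<^sup>2 / (2 * n * \<gamma> \<epsilon>) + M\<^sup>2 * \<gamma> \<epsilon> / 2"
      using n \<gamma> by (simp add: field_simps power2_eq_square)
    also have "\<dots> \<le> \<epsilon> / 4 + \<epsilon> / 4 + \<epsilon> / 2"
    proof (intro add_mono)
      have "4 * \<phi>\<^sub>0 / \<epsilon> \<le> n"
        using T_lower[of \<epsilon>] parts by (simp add: n_def)
      then show "\<phi>\<^sub>0 / n \<le> \<epsilon> / 4"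
        using n \<epsilon> by (simp add: field_simps)
      have "C / \<epsilon>\<^sup>2 \<le> n"
        using T_lower[of \<epsilon>] parts by (simp add: n_def)
      then show "(norm u)\<^sup>2 / (2 * n * \<gamma> \<epsilon>) \<le> \<epsilon> / 4"
        using n \<epsilon> m by (simp add: field_simps C_def \<gamma>_def power2_eq_square)
      show "M\<^sup>2 * \<gamma> \<epsilon> / 2 \<le> \<epsilon> / 2"
        using \<epsilon> m by (simp add: field_simps \<gamma>_def)
    qed
    finally show "approx_minimax_solution f V k X (1 - 1 / exp 1) \<epsilon> z"
      unfolding approx_minimax_solution_def inf by simp
  qed
  ultimately show ?thesis
    by blast
qed

end
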